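(* The edge-locating chromatic number is not monotone under taking subgraphs: there exist finite simple connected graphs $G$ and $H$ such that $G$ is a proper subgraph of $H$ and $\chi'_L(H)<\chi'_L(G)$.
   Context: For a proper edge coloring $c:E(G)\to\{1,\dots,k\}$ of a connected graph $G$, let $\pi=(\mathcal{C}_1,\dots,\mathcal{C}_k)$ be the ordered partition of $E(G)$ into color classes. For a vertex $v$ and an edge $e=xy$, $d(v,e)=\min\{d(v,x),d(v,y)\}$, and $d(v,\mathcal{C}_i)=\min\{d(v,e): e\in\mathcal{C}_i\}$. The edge color code of $v$ is $c_\pi(v)=(d(v,\mathcal{C}_1),\dots,d(v,\mathcal{C}_k))$. The coloring is an edge-locating coloring if distinct vertices have distinct edge color codes; $\chi'_L(G)$ is the minimum number of colors in an edge-locating coloring of $G$. *)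

theory Defs
  imports Main
begin

record 'a graph =
  verts :: "'a set"
  edges :: "'a set set"

definition simple_graph :: "'a graph \<Rightarrow> bool" where
  "simple_graph G \<longleftrightarrow> finite (verts G) \<and> (\<forall>e\<in>edges G. e \<subseteq> verts G \<and> card e = 2)"

definition proper_subgraph :: "'a graph \<Rightarrow> 'a graph \<Rightarrow> bool" where
  "proper_subgraph G H \<longleftrightarrow> verts G \<subseteq> verts H \<and> edges G \<subseteq> edges H \<and> G \<noteq> H"

definition walk :: "'a graph \<Rightarrow> 'a \<Rightarrow> 'a list \<Rightarrow> 'a \<Rightarrow> bool" where
  "walk G u p v \<longleftrightarrow> p \<noteq> [] \<and> hd p = u \<and> last p = v \<and> set p \<subseteq> verts G
     \<and> successively (\<lambda>x y. {x, y} \<in> edges G) p"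

definition connected_graph :: "'a graph \<Rightarrow> bool" where
  "connected_graph G \<longleftrightarrow> verts G \<noteq> {} \<and> (\<forall>u\<in>verts G. \<forall>v\<in>verts G. \<exists>p. walk G u p v)"

(* A walk of length n has n + 1 vertices. The value is meaningful only if u and v are joined
   by a walk, which is always the case in a connected graph. *)
definition gdist :: "'a graph \<Rightarrow> 'a \<Rightarrow> 'a \<Rightarrow> nat" where
  "gdist G u v = (LEAST n. \<exists>p. walk G u p v \<and> length p = Suc n)"

definition edge_dist :: "'a graph \<Rightarrow> 'a \<Rightarrow> 'a set \<Rightarrow> nat" where
  "edge_dist G v e = Min (gdist G v ` e)"

definition color_class :: "'a graph \<Rightarrow> ('a set \<Rightarrow> nat) \<Rightarrow> nat \<Rightarrow> 'a set set" where
  "color_class G c i = {e \<in> edges G. c e = i}"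

definition class_dist :: "'a graph \<Rightarrow> 'a \<Rightarrow> 'a set set \<Rightarrow> nat" where
  "class_dist G v C = Min (edge_dist G v ` C)"

(* All k colors have to occur: the color classes are the blocks of a partition of the edge set,
   hence nonempty, and so the minimum in class_dist is taken over a nonempty set. *)
definition proper_edge_coloring :: "'a graph \<Rightarrow> nat \<Rightarrow> ('a set \<Rightarrow> nat) \<Rightarrow> bool" where
  "proper_edge_coloring G k c \<longleftrightarrow> c ` edges G = {1..k}
     \<and> (\<forall>e\<in>edges G. \<forall>f\<in>edges G. e \<noteq> f \<and> e \<inter> f \<noteq> {} \<longrightarrow> c e \<noteq> c f)"

definition edge_color_code :: "'a graph \<Rightarrow> nat \<Rightarrow> ('a set \<Rightarrow> nat) \<Rightarrow> 'a \<Rightarrow> nat list" where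
  "edge_color_code G k c v = map (\<lambda>i. class_dist G v (color_class G c i)) [1..<Suc k]"

definition edge_locating_coloring :: "'a graph \<Rightarrow> nat \<Rightarrow> ('a set \<Rightarrow> nat) \<Rightarrow> bool" where
  "edge_locating_coloring G k c \<longleftrightarrow>
     proper_edge_coloring G k c \<and> inj_on (edge_color_code G k c) (verts G)"

definition edge_locating_colorable :: "'a graph \<Rightarrow> bool" where
  "edge_locating_colorable G \<longleftrightarrow> (\<exists>k c. edge_locating_coloring G k c)"

(* Some connected graphs, such as the complete graph on two vertices, have no edge-locating
   coloring; on those this number is unspecified. *)
definition edge_locating_chromatic_number :: "'a graph \<Rightarrow> nat" where
  "edge_locating_chromatic_number G = (LEAST k. \<exists>c. edge_locating_coloring G k c)"

end

theory Submission
  imports Defs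
begin

text \<open>
  Let \<open>G\<close> be the bowtie, two triangles \<open>0 1 3\<close> and \<open>0 2 4\<close> sharing the vertex \<open>0\<close>, and let
  \<open>H\<close> be \<open>G\<close> with the edge \<open>1 2\<close> added. The four edges at \<open>0\<close> need four colors. If there are
  only four, then every vertex is at distance at most \<open>1\<close> from every color class, so its code
  is determined by the set of colors seen at it. In \<open>G\<close> write \<open>a\<^sub>j\<close> for the color of \<open>0 j\<close>.
  The color of \<open>1 3\<close> is \<open>a\<^sub>i\<close> for some \<open>i \<in> {2, 4}\<close>, and that of \<open>2 4\<close> is \<open>a\<^sub>j\<close> for some
  \<open>j \<in> {1, 3}\<close>; then the vertices \<open>i\<close> and \<open>j\<close> both see exactly \<open>a\<^sub>i\<close> and \<open>a\<^sub>j\<close>. Hence \<open>G\<close> needs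
  five colors. In \<open>H\<close>, coloring \<open>i j\<close> by \<open>(i + j) mod 5\<close> uses four colors, and distinct vertices
  see distinct sets of colors.
\<close>

definition seen_colors :: "'a graph \<Rightarrow> ('a set \<Rightarrow> nat) \<Rightarrow> 'a \<Rightarrow> nat set" where
  "seen_colors G c v = c ` {e \<in> edges G. v \<in> e}"

lemma finite_edges:
  assumes "simple_graph G"
  shows "finite (edges G)"
proof (rule finite_subset)
  show "edges G \<subseteq> Pow (verts G)"
    using assms by (auto simp: simple_graph_def)
  show "finite (Pow (verts G))"
    using assms by (simp add: simple_graph_def)
qed

lemma edge_finite_nonempty:
  assumes "simple_graph G" "e \<in> edges G"
  shows "finite e" "e \<noteq> {}"
  using assms by (auto simp: simple_graph_def intro: card_ge_0_finite)

lemma gdist_le: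
  assumes "walk G u p v" "length p = Suc n"
  shows "gdist G u v \<le> n"
  unfolding gdist_def using assms by (blast intro: Least_le)

text \<open>Connectedness provides some walk, so the \<open>LEAST\<close> in \<open>gdist\<close> is
  attained; a walk attaining 0 has a single vertex.\<close>

lemma gdist_eq_0_iff:
  assumes "connected_graph G" "u \<in> verts G" "v \<in> verts G"
  shows "gdist G u v = 0 \<longleftrightarrow> u = v"
proof
  obtain p where p: "walk G u p v"
    using assms by (auto simp: connected_graph_def)
  then have "length p = Suc (length p - 1)"
    by (cases p) (auto simp: walk_def)
  with p have "\<exists>n p. walk G u p v \<and> length p = Suc n" by blast
  then have "\<exists>p. walk G u p v \<and> length p = Suc (gdist G u v)"
    unfolding gdist_def by (rule LeastI_ex)
  moreover assume "gdist G u v = 0"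
  ultimately show "u = v"
    by (auto simp: walk_def length_Suc_conv)
next
  assume "u = v"
  then have "walk G u [u] v" using assms by (simp add: walk_def)
  then have "gdist G u v \<le> 0" by (rule gdist_le) simp
  then show "gdist G u v = 0" by simp
qed

lemma gdist_adjacent_le:
  assumes "simple_graph G" "{u, v} \<in> edges G"
  shows "gdist G u v \<le> 1"
proof (rule gdist_le)
  show "walk G u [u, v] v"
    using assms by (auto simp: walk_def simple_graph_def)
qed simp

lemma edge_dist_eq_0_iff:
  assumes "simple_graph G" "connected_graph G" "v \<in> verts G" "e \<in> edges G"
  shows "edge_dist G v e = 0 \<longleftrightarrow> v \<in> e"
proof -
  have e: "finite e" "e \<noteq> {}" "e \<subseteq> verts G"
    using edge_finite_nonempty[OF assms(1,4)] assms(1,4) by (auto simp: simple_graph_def)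
  \<comment> \<open>On \<open>nat\<close>, \<open>\<le> 0\<close> means \<open>= 0\<close>; the
    inequality has the shape that \<open>Min_le_iff\<close> expects.\<close>
  then have "edge_dist G v e \<le> 0 \<longleftrightarrow> (\<exists>x\<in>e. gdist G v x \<le> 0)"
    unfolding edge_dist_def by (subst Min_le_iff) auto
  also have "\<dots> \<longleftrightarrow> v \<in> e"
    using gdist_eq_0_iff[OF assms(2,3)] e(3) by auto
  finally show ?thesis by simp
qed

text \<open>Since color \<open>i\<close> occurs, its class is nonempty and the \<open>Min\<close> is
  attained. So the zero entries of a code mark exactly the seen colors.\<close>

lemma class_dist_eq_0_iff:
  assumes "simple_graph G" "connected_graph G" "v \<in> verts G" "i \<in> c ` edges G"
  shows "class_dist G v (color_class G c i) = 0 \<longleftrightarrow> i \<in> seen_colors G c v"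
proof -
  let ?C = "color_class G c i"
  have C: "finite ?C" "?C \<noteq> {}" "?C \<subseteq> edges G"
    using finite_edges[OF assms(1)] assms(4) by (auto simp: color_class_def)
  then have "class_dist G v ?C \<le> 0 \<longleftrightarrow> (\<exists>e\<in>?C. edge_dist G v e \<le> 0)"
    unfolding class_dist_def by (subst Min_le_iff) auto
  also have "\<dots> \<longleftrightarrow> (\<exists>e\<in>?C. v \<in> e)"
    using edge_dist_eq_0_iff[OF assms(1-3)] C(3) by auto
  finally show ?thesis by (auto simp: color_class_def seen_colors_def)
qed

lemma class_dist_le_1:
  assumes "simple_graph G" "{v, z} \<in> edges G" "i \<in> seen_colors G c z"
  shows "class_dist G v (color_class G c i) \<le> 1"
proof -
  obtain e where e: "e \<in> edges G" "z \<in> e" "c e = i"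
    using assms(3) by (auto simp: seen_colors_def)
  have "class_dist G v (color_class G c i) \<le> edge_dist G v e"
    unfolding class_dist_def using finite_edges[OF assms(1)] e
    by (intro Min_le) (auto simp: color_class_def)
  also have "\<dots> \<le> gdist G v z"
    unfolding edge_dist_def using edge_finite_nonempty[OF assms(1) e(1)] e(2)
    by (intro Min_le) auto
  also have "\<dots> \<le> 1" using assms(1,2) by (rule gdist_adjacent_le)
  finally show ?thesis .
qed

lemma edge_color_code_eq_iff:
  "edge_color_code G k c u = edge_color_code G k c v \<longleftrightarrow>
     (\<forall>i\<in>{1..k}. class_dist G u (color_class G c i) = class_dist G v (color_class G c i))"
  by (auto simp: edge_color_code_def simp del: upt_Suc)

lemma seen_colors_eq_if_code_eq:
  assumes "simple_graph G" "connected_graph G" "u \<in> verts G" "v \<in> verts G"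
    and "c ` edges G = {1..k}" "edge_color_code G k c u = edge_color_code G k c v"
  shows "seen_colors G c u = seen_colors G c v"
proof -
  have "i \<in> seen_colors G c u \<longleftrightarrow> i \<in> seen_colors G c v" if "i \<in> c ` edges G" for i
    using class_dist_eq_0_iff[OF assms(1,2,3) that] class_dist_eq_0_iff[OF assms(1,2,4) that]
      assms(5,6) that by (simp add: edge_color_code_eq_iff)
  then show ?thesis by (auto simp: seen_colors_def)
qed

text \<open>The common neighbor \<open>z\<close> sees every color, so all entries of both codes are
  0 or 1, and the seen colors tell which are 0.\<close>

lemma code_eq_if_seen_colors_eq:
  assumes "simple_graph G" "connected_graph G" "c ` edges G = {1..k}"
    and "{u, z} \<in> edges G" "{v, z} \<in> edges G" "{1..k} \<subseteq> seen_colors G c z"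
    and "seen_colors G c u = seen_colors G c v"
  shows "edge_color_code G k c u = edge_color_code G k c v"
  unfolding edge_color_code_eq_iff
proof
  fix i assume i: "i \<in> {1..k}"
  have uv: "u \<in> verts G" "v \<in> verts G"
    using assms(1,4,5) by (auto simp: simple_graph_def)
  have "class_dist G u (color_class G c i) \<le> 1" "class_dist G v (color_class G c i) \<le> 1"
    using class_dist_le_1[OF assms(1,4)] class_dist_le_1[OF assms(1,5)] assms(6) i by auto
  moreover have "class_dist G u (color_class G c i) = 0 \<longleftrightarrow> class_dist G v (color_class G c i) = 0"
    using class_dist_eq_0_iff[OF assms(1,2)] uv assms(3,7) i by auto
  ultimately show "class_dist G u (color_class G c i) = class_dist G v (color_class G c i)"
    by linarith
qed

text \<open>A sufficient criterion that spares computing any distance: the code determines the set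
  of seen colors, so it separates vertices whenever that set does.\<close>

lemma edge_locating_coloringI:
  assumes "simple_graph G" "connected_graph G" "proper_edge_coloring G k c"
    and "inj_on (seen_colors G c) (verts G)"
  shows "edge_locating_coloring G k c"
  unfolding edge_locating_coloring_def
proof (intro conjI inj_onI)
  show "proper_edge_coloring G k c" by fact
  fix u v assume *: "u \<in> verts G" "v \<in> verts G"
    "edge_color_code G k c u = edge_color_code G k c v"
  moreover have "c ` edges G = {1..k}" using assms(3) by (simp add: proper_edge_coloring_def)
  ultimately have "seen_colors G c u = seen_colors G c v"
    using assms(1,2) by (intro seen_colors_eq_if_code_eq)
  with * assms(4) show "u = v" by (auto dest: inj_onD)
qed

lemma connected_graph_if_dominating:
  assumes "z \<in> verts G" "\<And>v. v \<in> verts G \<Longrightarrow> v \<noteq> z \<Longrightarrow> {z, v} \<in> edges G"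
  shows "connected_graph G"
  unfolding connected_graph_def
proof (intro conjI ballI)
  show "verts G \<noteq> {}" using assms(1) by auto
  fix u v assume uv: "u \<in> verts G" "v \<in> verts G"
  \<comment> \<open>An endpoint equal to \<open>z\<close> is left out, since repeating
    \<open>z\<close> would require \<open>{z, z}\<close> to be an edge.\<close>
  let ?p = "(if u = z then [] else [u]) @ [z] @ (if v = z then [] else [v])"
  have "walk G u ?p v"
    using assms uv by (auto simp: walk_def insert_commute)
  then show "\<exists>p. walk G u p v" ..
qed

definition bowtie :: "nat graph" where
  "bowtie = \<lparr>verts = {0, 1, 2, 3, 4}, edges = {{0, 1}, {0, 2}, {0, 3}, {0, 4}, {1, 3}, {2, 4}}\<rparr>"

definition bowtie_plus :: "nat graph" where
  "bowtie_plus = \<lparr>verts = verts bowtie, edges = insert {1, 2} (edges bowtie)\<rparr>"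

lemma simple_bowtie: "simple_graph bowtie"
  by (simp add: simple_graph_def bowtie_def)

lemma simple_bowtie_plus: "simple_graph bowtie_plus"
  by (simp add: simple_graph_def bowtie_plus_def bowtie_def)

lemma connected_bowtie: "connected_graph bowtie"
  by (rule connected_graph_if_dominating[of 0]) (auto simp: bowtie_def)

lemma connected_bowtie_plus: "connected_graph bowtie_plus"
  by (rule connected_graph_if_dominating[of 0]) (auto simp: bowtie_plus_def bowtie_def)

lemma seen_colors_empty: "seen_colors \<lparr>verts = V, edges = {}\<rparr> c v = {}"
  by (simp add: seen_colors_def)

text \<open>Lets the simplifier evaluate \<open>seen_colors\<close> edge by edge on a concrete
  graph.\<close>

lemma seen_colors_insert:
  "seen_colors \<lparr>verts = V, edges = insert e E\<rparr> c v =
     (if v \<in> e then insert (c e) (seen_colors \<lparr>verts = V, edges = E\<rparr> c v)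
      else seen_colors \<lparr>verts = V, edges = E\<rparr> c v)"
  by (auto simp: seen_colors_def)

text \<open>Edge \<open>0 j\<close> gets color \<open>j\<close>, edge \<open>1 3\<close> gets 4, and
  edge \<open>2 4\<close> gets 5, its sum 6 being capped.\<close>

lemma bowtie_coloring: "edge_locating_coloring bowtie 5 (\<lambda>e. min 5 (\<Sum>e))"
proof (rule edge_locating_coloringI[OF simple_bowtie connected_bowtie])
  have "{1..5} = {1, 2, 3, 4, 5::nat}" by auto
  then show "proper_edge_coloring bowtie 5 (\<lambda>e. min 5 (\<Sum>e))"
    by (simp add: proper_edge_coloring_def bowtie_def numeral_2_eq_2[symmetric])
  show "inj_on (seen_colors bowtie (\<lambda>e. min 5 (\<Sum>e))) (verts bowtie)"
    by (simp add: bowtie_def seen_colors_empty seen_colors_insert set_eq_subset)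
qed

text \<open>Edges sharing a vertex have different sums mod 5, so the coloring is proper. Color 0
  does not occur because \<open>1 4\<close> and \<open>2 3\<close> are not edges.\<close>

lemma bowtie_plus_coloring: "edge_locating_coloring bowtie_plus 4 (\<lambda>e. \<Sum>e mod 5)"
proof (rule edge_locating_coloringI[OF simple_bowtie_plus connected_bowtie_plus])
  have "{1..4} = {1, 2, 3, 4::nat}" by auto
  then show "proper_edge_coloring bowtie_plus 4 (\<lambda>e. \<Sum>e mod 5)"
    by (simp add: proper_edge_coloring_def bowtie_plus_def bowtie_def insert_commute
        numeral_2_eq_2[symmetric])
  show "inj_on (seen_colors bowtie_plus (\<lambda>e. \<Sum>e mod 5)) (verts bowtie_plus)"
    by (simp add: bowtie_plus_def bowtie_def seen_colors_empty seen_colors_insert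
        set_eq_subset)
qed

lemma bowtie_coloring_ge_5:
  assumes "edge_locating_coloring bowtie k c"
  shows "5 \<le> k"
proof (rule ccontr)
  assume "\<not> 5 \<le> k"
  have c: "c ` edges bowtie = {1..k}"
    and proper: "\<And>e f. e \<in> edges bowtie \<Longrightarrow> f \<in> edges bowtie \<Longrightarrow> e \<noteq> f \<Longrightarrow> e \<inter> f \<noteq> {} \<Longrightarrow> c e \<noteq> c f"
    and inj: "inj_on (edge_color_code bowtie k c) (verts bowtie)"
    using assms by (auto simp: edge_locating_coloring_def proper_edge_coloring_def)
  let ?a = "\<lambda>j. c {0, j}"
  have a: "distinct [?a 1, ?a 2, ?a 3, ?a 4]"
    using proper by (simp add: bowtie_def doubleton_eq_iff)
  have seen: "seen_colors bowtie c 0 = {?a 1, ?a 2, ?a 3, ?a 4}"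
    "seen_colors bowtie c 1 = {?a 1, c {1, 3}}" "seen_colors bowtie c 3 = {?a 3, c {1, 3}}"
    "seen_colors bowtie c 2 = {?a 2, c {2, 4}}" "seen_colors bowtie c 4 = {?a 4, c {2, 4}}"
    by (simp_all add: bowtie_def seen_colors_empty seen_colors_insert)
  have "seen_colors bowtie c 0 = {1..k}"
  proof (rule card_subset_eq)
    show sub: "seen_colors bowtie c 0 \<subseteq> {1..k}"
      unfolding c[symmetric] by (auto simp: seen_colors_def)
    have "card (seen_colors bowtie c 0) = 4"
      using distinct_card[OF a] by (simp add: seen(1))
    \<comment> \<open>The four colors at 0 give \<open>4 \<le> k\<close>, and the negated claim
      gives \<open>k \<le> 4\<close>.\<close>
    then show "card (seen_colors bowtie c 0) = card {1..k}"
      using card_mono[OF _ sub] \<open>\<not> 5 \<le> k\<close> by simp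
  qed simp
  then have all: "{1..k} = {?a 1, ?a 2, ?a 3, ?a 4}" "{1..k} \<subseteq> seen_colors bowtie c 0"
    using seen(1) by auto
  have "c {1, 3} \<in> {1..k}" "c {2, 4} \<in> {1..k}"
    unfolding c[symmetric] by (auto simp: bowtie_def)
  moreover have "c {1, 3} \<noteq> ?a 1" "c {1, 3} \<noteq> ?a 3" "c {2, 4} \<noteq> ?a 2" "c {2, 4} \<noteq> ?a 4"
    by (rule proper; simp add: bowtie_def doubleton_eq_iff)+
  ultimately have "c {1, 3} = ?a 2 \<or> c {1, 3} = ?a 4" "c {2, 4} = ?a 1 \<or> c {2, 4} = ?a 3"
    unfolding all(1) by auto
  then have "\<exists>i\<in>{2, 4}. c {1, 3} = ?a i" "\<exists>j\<in>{1, 3}. c {2, 4} = ?a j"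
    by simp_all
  then obtain i j where ij: "i \<in> {2, 4}" "j \<in> {1, 3}" "c {1, 3} = ?a i" "c {2, 4} = ?a j"
    by (elim bexE)
  \<comment> \<open>Vertex \<open>i\<close> lies on edge \<open>2 4\<close>, which has color
    \<open>?a j\<close>, and \<open>j\<close> lies on \<open>1 3\<close>, which has color
    \<open>?a i\<close>.\<close>
  then have "seen_colors bowtie c i = seen_colors bowtie c j"
    by (elim insertE emptyE) (simp_all add: seen insert_commute del: One_nat_def)
  moreover have "{i, 0} \<in> edges bowtie" "{j, 0} \<in> edges bowtie"
    using ij(1,2) by (auto simp: bowtie_def)
  ultimately have "edge_color_code bowtie k c i = edge_color_code bowtie k c j"
    using code_eq_if_seen_colors_eq[OF simple_bowtie connected_bowtie c] all(2) by blast
  moreover have "i \<in> verts bowtie" "j \<in> verts bowtie" "i \<noteq> j"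
    using ij(1,2) by (auto simp: bowtie_def)
  ultimately show False
    using inj_onD[OF inj] by blast
qed

theorem theorem16:
  "\<exists>G H :: nat graph.
     simple_graph G \<and> connected_graph G \<and> simple_graph H \<and> connected_graph H
     \<and> proper_subgraph G H
     \<and> edge_locating_colorable G \<and> edge_locating_colorable H
     \<and> edge_locating_chromatic_number H < edge_locating_chromatic_number G"
proof -
  have "{1, 2} \<in> edges bowtie_plus" "{1, 2} \<notin> edges bowtie"
    by (simp_all add: bowtie_plus_def bowtie_def doubleton_eq_iff)
  then have "bowtie \<noteq> bowtie_plus" by metis
  then have "proper_subgraph bowtie bowtie_plus"
    by (simp add: proper_subgraph_def bowtie_plus_def subset_insertI)
  moreover have "edge_locating_colorable bowtie" "edge_locating_colorable bowtie_plus"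
    unfolding edge_locating_colorable_def using bowtie_coloring bowtie_plus_coloring by blast+
  moreover have "edge_locating_chromatic_number bowtie_plus < edge_locating_chromatic_number bowtie"
  proof -
    have "edge_locating_chromatic_number bowtie_plus \<le> 4"
      unfolding edge_locating_chromatic_number_def
      by (rule Least_le, rule exI, rule bowtie_plus_coloring)
    \<comment> \<open>The explicit 5-coloring ensures that the \<open>LEAST\<close> is attained;
      only then does the lower bound apply to it.\<close>
    moreover have "\<exists>c. edge_locating_coloring bowtie (edge_locating_chromatic_number bowtie) c"
      unfolding edge_locating_chromatic_number_def
      by (rule LeastI_ex, rule exI, rule exI, rule bowtie_coloring)
    then have "5 \<le> edge_locating_chromatic_number bowtie"
      using bowtie_coloring_ge_5 by blast
    ultimately show ?thesis by linarith
  qed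
  ultimately show ?thesis
    using simple_bowtie connected_bowtie simple_bowtie_plus connected_bowtie_plus by blast
qed

end
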